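(* Let $K$ be a field and $G$ a finite group. For any $f\in KG$, define $T_f\colon KG\to KG$ by $v\mapsto fv$. Then $$|\mathrm{supp}(f)|\cdot \mathrm{rank}_K(T_f)\geq |G|.$$
   Context: $KG$ is the group algebra of $G$ over $K$. For $f=\sum_{g\in G}a_g g\in KG$ with $a_g\in K$, $\mathrm{supp}(f)=\{g\in G\mid a_g\neq 0\}$. The map $T_f$ is $K$-linear and $\mathrm{rank}_K(T_f)$ is its rank over $K$.
   Formalization: The element f is assumed to be nonzero; for f = 0 the support is empty and the rank is 0, so the printed inequality would read 0 ≥ |G|, which is false. *)

theory Defs
  imports "Jordan_Normal_Form.Missing_VectorSpace" "HOL-Algebra.Coset"
begin

section \<open>The group algebra of a finite group\<close>

text \<open>A formal sum \<open>\<Sum>\<^sub>g a\<^sub>g g\<close> is its coefficient function \<open>g \<mapsto> a\<^sub>g\<close>, taken to be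
  \<^const>\<open>undefined\<close> outside the group so that equality is extensional. All coefficient functions
  are admitted and products are summed over the whole group, so the definition is only meant
  for finite \<open>G\<close>. In the product, the coefficient at \<open>g\<close> collects all factorizations
  \<open>g = h (h\<^sup>-\<^sup>1 g)\<close>.\<close>

definition group_algebra ::
  "('k, 'm) ring_scheme \<Rightarrow> ('g, 'n) monoid_scheme \<Rightarrow> ('k, 'g \<Rightarrow> 'k) module" where
  "group_algebra K G =
    \<lparr>carrier = carrier G \<rightarrow>\<^sub>E carrier K,
     mult = (\<lambda>a b. \<lambda>g\<in>carrier G.
       \<Oplus>\<^bsub>K\<^esub>h\<in>carrier G. a h \<otimes>\<^bsub>K\<^esub> b (inv\<^bsub>G\<^esub> h \<otimes>\<^bsub>G\<^esub> g)),
     one = (\<lambda>g\<in>carrier G. if g = \<one>\<^bsub>G\<^esub> then \<one>\<^bsub>K\<^esub> else \<zero>\<^bsub>K\<^esub>),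
     zero = (\<lambda>g\<in>carrier G. \<zero>\<^bsub>K\<^esub>),
     add = (\<lambda>a b. \<lambda>g\<in>carrier G. a g \<oplus>\<^bsub>K\<^esub> b g),
     smult = (\<lambda>c a. \<lambda>g\<in>carrier G. c \<otimes>\<^bsub>K\<^esub> a g)\<rparr>"

definition supp :: "('k, 'm) ring_scheme \<Rightarrow> ('g, 'n) monoid_scheme \<Rightarrow> ('g \<Rightarrow> 'k) \<Rightarrow> 'g set" where
  "supp K G f = {g \<in> carrier G. f g \<noteq> \<zero>\<^bsub>K\<^esub>}"

definition left_mult ::
  "('k, 'm) ring_scheme \<Rightarrow> ('g, 'n) monoid_scheme \<Rightarrow> ('g \<Rightarrow> 'k) \<Rightarrow> ('g \<Rightarrow> 'k) \<Rightarrow> ('g \<Rightarrow> 'k)" where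
  "left_mult K G f = (\<lambda>v. f \<otimes>\<^bsub>group_algebra K G\<^esub> v)"

text \<open>The rank of a linear map \<open>T : V \<rightarrow> W\<close> over \<open>K\<close>. Since \<^const>\<open>vectorspace.dim\<close> is natural-number
  valued, this is only meaningful when the image is finite-dimensional.\<close>

definition linear_rank ::
  "('k, 'm) ring_scheme \<Rightarrow> ('k, 'v, 'a) module_scheme \<Rightarrow> ('k, 'w, 'b) module_scheme
    \<Rightarrow> ('v \<Rightarrow> 'w) \<Rightarrow> nat" where
  "linear_rank K V W T = vectorspace.dim K (W\<lparr>carrier := T ` carrier V\<rparr>)"

section \<open>The vector space structure\<close>

lemma group_algebra_simps [simp]:
  "carrier (group_algebra K G) = carrier G \<rightarrow>\<^sub>E carrier K"
  "\<zero>\<^bsub>group_algebra K G\<^esub> = (\<lambda>g\<in>carrier G. \<zero>\<^bsub>K\<^esub>)"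
  "a \<oplus>\<^bsub>group_algebra K G\<^esub> b = (\<lambda>g\<in>carrier G. a g \<oplus>\<^bsub>K\<^esub> b g)"
  "c \<odot>\<^bsub>group_algebra K G\<^esub> a = (\<lambda>g\<in>carrier G. c \<otimes>\<^bsub>K\<^esub> a g)"
  "\<one>\<^bsub>group_algebra K G\<^esub> = (\<lambda>g\<in>carrier G. if g = \<one>\<^bsub>G\<^esub> then \<one>\<^bsub>K\<^esub> else \<zero>\<^bsub>K\<^esub>)"
  "a \<otimes>\<^bsub>group_algebra K G\<^esub> b = (\<lambda>g\<in>carrier G.
     \<Oplus>\<^bsub>K\<^esub>h\<in>carrier G. a h \<otimes>\<^bsub>K\<^esub> b (inv\<^bsub>G\<^esub> h \<otimes>\<^bsub>G\<^esub> g))"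
  by (simp_all add: group_algebra_def)

lemma group_algebra_vectorspace:
  fixes K (structure)
  assumes "field K"
  shows "vectorspace K (group_algebra K G)"
proof -
  interpret field K by fact
  have "abelian_group (group_algebra K G)"
  proof (rule abelian_groupI)
    fix x assume x: "x \<in> carrier (group_algebra K G)"
    show "\<exists>y\<in>carrier (group_algebra K G). y \<oplus>\<^bsub>group_algebra K G\<^esub> x = \<zero>\<^bsub>group_algebra K G\<^esub>"
      using x by (intro bexI[of _ "\<lambda>g\<in>carrier G. \<ominus> x g"]) (auto simp: PiE_iff l_neg)
  qed (auto simp: PiE_iff a_ac extensional_def fun_eq_iff)
  then have "module K (group_algebra K G)"
    by (intro module.intro module_axioms.intro)
      (auto simp: PiE_iff extensional_def fun_eq_iff l_distr r_distr m_assoc is_cring)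
  then show ?thesis
    by (simp add: vectorspace_def assms)
qed

lemma left_mult_linear_map:
  fixes K (structure)
  assumes "field K" "group G" "finite (carrier G)" "f \<in> carrier (group_algebra K G)"
  shows "linear_map K (group_algebra K G) (group_algebra K G) (left_mult K G f)"
proof -
  interpret field K by fact
  interpret G: group G by fact
  interpret V: vectorspace K "group_algebra K G"
    by (rule group_algebra_vectorspace) fact
  have f: "\<And>g. g \<in> carrier G \<Longrightarrow> f g \<in> carrier K"
    using assms(4) by auto
  have "mod_hom K (group_algebra K G) (group_algebra K G) (left_mult K G f)"
  proof (intro mod_hom.intro mod_hom_axioms.intro V.module_axioms, unfold module_hom_def, safe)
    show "left_mult K G f v \<in> carrier (group_algebra K G)"
      if "v \<in> carrier (group_algebra K G)" for v
      using that f by (auto simp: left_mult_def PiE_iff intro!: finsum_closed)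
    show "left_mult K G f (v \<oplus>\<^bsub>group_algebra K G\<^esub> w) =
        left_mult K G f v \<oplus>\<^bsub>group_algebra K G\<^esub> left_mult K G f w"
      if "v \<in> carrier (group_algebra K G)" "w \<in> carrier (group_algebra K G)" for v w
    proof -
      have [simp]: "v x \<in> carrier K" "w x \<in> carrier K" if "x \<in> carrier G" for x
        using \<open>v \<in> _\<close> \<open>w \<in> _\<close> that by auto
      have "(\<Oplus>h\<in>carrier G. f h \<otimes> (\<lambda>u\<in>carrier G. v u \<oplus> w u) (inv\<^bsub>G\<^esub> h \<otimes>\<^bsub>G\<^esub> g)) =
          (\<Oplus>h\<in>carrier G. f h \<otimes> v (inv\<^bsub>G\<^esub> h \<otimes>\<^bsub>G\<^esub> g)) \<oplus>
          (\<Oplus>h\<in>carrier G. f h \<otimes> w (inv\<^bsub>G\<^esub> h \<otimes>\<^bsub>G\<^esub> g))" if "g \<in> carrier G" for g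
        using that
        by (subst finsum_addf[symmetric])
          (auto simp: r_distr f simp del: finsum_addf intro!: finsum_cong')
      then show ?thesis
        by (auto simp: left_mult_def fun_eq_iff)
    qed
    show "left_mult K G f (c \<odot>\<^bsub>group_algebra K G\<^esub> v) =
        c \<odot>\<^bsub>group_algebra K G\<^esub> left_mult K G f v"
      if "c \<in> carrier K" "v \<in> carrier (group_algebra K G)" for c v
    proof -
      have [simp]: "v x \<in> carrier K" if "x \<in> carrier G" for x
        using \<open>v \<in> _\<close> that by auto
      have "(\<Oplus>h\<in>carrier G. f h \<otimes> (\<lambda>u\<in>carrier G. c \<otimes> v u) (inv\<^bsub>G\<^esub> h \<otimes>\<^bsub>G\<^esub> g)) =
          c \<otimes> (\<Oplus>h\<in>carrier G. f h \<otimes> v (inv\<^bsub>G\<^esub> h \<otimes>\<^bsub>G\<^esub> g))" if "g \<in> carrier G" for g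
        using that \<open>c \<in> carrier K\<close> assms(3)
        by (subst finsum_rdistr) (auto simp: m_lcomm f intro!: finsum_cong')
      then show ?thesis
        by (auto simp: left_mult_def fun_eq_iff)
    qed
  qed
  then show ?thesis
    by (simp add: linear_map_def V.vectorspace_axioms)
qed

text \<open>The product extends the group law: \<open>\<delta>\<^sub>x \<delta>\<^sub>y = \<delta>\<^sub>x\<^sub>y\<close>.\<close>

lemma group_algebra_mult_basis:
  fixes K (structure)
  assumes "field K" "group G" "finite (carrier G)" "x \<in> carrier G" "y \<in> carrier G"
  defines "\<delta> \<equiv> \<lambda>z. \<lambda>g\<in>carrier G. if g = z then \<one> else \<zero>"
  shows "\<delta> x \<otimes>\<^bsub>group_algebra K G\<^esub> \<delta> y = \<delta> (x \<otimes>\<^bsub>G\<^esub> y)"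
proof -
  interpret field K by fact
  interpret G: group G by fact
  have "(\<Oplus>h\<in>carrier G. \<delta> x h \<otimes> \<delta> y (inv\<^bsub>G\<^esub> h \<otimes>\<^bsub>G\<^esub> g)) = \<delta> (x \<otimes>\<^bsub>G\<^esub> y) g"
    if g: "g \<in> carrier G" for g
  proof -
    have "(\<Oplus>h\<in>carrier G. \<delta> x h \<otimes> \<delta> y (inv\<^bsub>G\<^esub> h \<otimes>\<^bsub>G\<^esub> g)) =
        (\<Oplus>h\<in>carrier G. if x = h then \<delta> y (inv\<^bsub>G\<^esub> h \<otimes>\<^bsub>G\<^esub> g) else \<zero>)"
      using g by (intro finsum_cong') (auto simp: \<delta>_def)
    also have "\<dots> = \<delta> y (inv\<^bsub>G\<^esub> x \<otimes>\<^bsub>G\<^esub> g)"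
      using g assms(3,4) by (intro finsum_singleton) (auto simp: \<delta>_def)
    also have "\<dots> = \<delta> (x \<otimes>\<^bsub>G\<^esub> y) g"
      using g assms(4,5) by (auto simp: \<delta>_def G.inv_solve_left' G.m_assoc[symmetric])
    finally show ?thesis .
  qed
  then show ?thesis
    by (auto simp: \<delta>_def fun_eq_iff)
qed

end

theory Submission
  imports Defs
begin

text \<open>Write \<open>T\<^sub>f\<close> for left multiplication by \<open>f\<close>. The translates \<open>T\<^sub>f \<delta>\<^sub>z = f z\<close> span the image of \<open>T\<^sub>f\<close>, so some
  set \<open>B\<close> of translates is a basis of it. Every vector of the image, in particular every translate,
  is supported in the union of the supports of the members of \<open>B\<close>. The translates of \<open>f \<noteq> 0\<close> jointly
  cover \<open>G\<close>, hence so do these \<open>rank T\<^sub>f\<close> supports, and each of them has as many elements as the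
  support of \<open>f\<close>.\<close>

lemma (in mod_hom) preimage_is_submodule:
  assumes "submodule R L N"
  shows "submodule R {v \<in> carrier M. f v \<in> L} M"
proof -
  interpret L: submodule R L N by fact
  show ?thesis
    by (rule submodule.intro) (use M.module_axioms in auto)
qed

lemma (in mod_hom) image_span_subset:
  assumes "S \<subseteq> carrier M"
  shows "f ` M.span S \<subseteq> N.span (f ` S)"
proof -
  have im: "f ` S \<subseteq> carrier N"
    using assms by auto
  then have "S \<subseteq> {v \<in> carrier M. f v \<in> N.span (f ` S)}"
    using assms N.in_own_span[OF im] by auto
  then have "M.span S \<subseteq> {v \<in> carrier M. f v \<in> N.span (f ` S)}"
    by (intro M.span_is_subset preimage_is_submodule N.span_is_submodule im)
  then show ?thesis
    by auto
qed

text \<open>A minimal generating subset is a basis. Choosing the basis inside \<open>S\<close>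
  matters later: a basis made of translates of \<open>f\<close> has members whose supports have
  controlled size.\<close>

lemma (in vectorspace) basis_subset_generating:
  assumes "finite S" "S \<subseteq> carrier V" "gen_set S"
  obtains B where "B \<subseteq> S" "basis B"
proof -
  obtain B where "B \<subseteq> S" "minimal B (\<lambda>S. S \<subseteq> carrier V \<and> gen_set S)"
    using minimal_exists[of S "\<lambda>S. S \<subseteq> carrier V \<and> gen_set S"] assms by auto
  then show ?thesis
    using min_gen_is_basis that by blast
qed

text \<open>Sums and scalar multiples create no new support points. Hence a bound \<open>U\<close>
  on the supports of some vectors passes to their whole span.\<close>

lemma supp_submodule:
  fixes K (structure)
  assumes "field K"
  shows "submodule K {v \<in> carrier (group_algebra K G). supp K G v \<subseteq> U} (group_algebra K G)"
proof -
  interpret field K by fact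
  interpret V: vectorspace K "group_algebra K G"
    by (rule group_algebra_vectorspace) fact
  have add: "supp K G (v \<oplus>\<^bsub>group_algebra K G\<^esub> w) \<subseteq> supp K G v \<union> supp K G w"
    if "v \<in> carrier (group_algebra K G)" "w \<in> carrier (group_algebra K G)" for v w
    using that by (auto simp: supp_def)
  have smult: "supp K G (c \<odot>\<^bsub>group_algebra K G\<^esub> v) \<subseteq> supp K G v" if "c \<in> carrier K" for c v
    using that by (auto simp: supp_def)
  have zero: "supp K G \<zero>\<^bsub>group_algebra K G\<^esub> = {}"
    by (auto simp: supp_def)
  show ?thesis
  proof (rule submodule.intro)
    show "v \<oplus>\<^bsub>group_algebra K G\<^esub> w \<in> {v \<in> carrier (group_algebra K G). supp K G v \<subseteq> U}"
      if "v \<in> {v \<in> carrier (group_algebra K G). supp K G v \<subseteq> U}"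
        "w \<in> {v \<in> carrier (group_algebra K G). supp K G v \<subseteq> U}" for v w
      using that add[of v w] V.M.add.m_closed[of v w] by blast
    show "c \<odot>\<^bsub>group_algebra K G\<^esub> v \<in> {v \<in> carrier (group_algebra K G). supp K G v \<subseteq> U}"
      if "c \<in> carrier K" "v \<in> {v \<in> carrier (group_algebra K G). supp K G v \<subseteq> U}" for c v
      using that smult[of c v] V.smult_closed[of c v] by blast
    show "\<zero>\<^bsub>group_algebra K G\<^esub> \<in> {v \<in> carrier (group_algebra K G). supp K G v \<subseteq> U}"
      using zero V.M.zero_closed by blast
  qed (auto intro: V.module_axioms)
qed

text \<open>For \<open>z\<close> in the group, this is \<open>z\<close> itself, regarded as an
  element of \<open>KG\<close>.\<close>

definition delta :: "('k, 'm) ring_scheme \<Rightarrow> ('g, 'n) monoid_scheme \<Rightarrow> 'g \<Rightarrow> 'g \<Rightarrow> 'k" where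
  "delta K G z = (\<lambda>g\<in>carrier G. if g = z then \<one>\<^bsub>K\<^esub> else \<zero>\<^bsub>K\<^esub>)"

lemma delta_closed:
  assumes "field K"
  shows "delta K G z \<in> carrier (group_algebra K G)"
proof -
  interpret field K by fact
  show ?thesis by (auto simp: delta_def)
qed

lemma span_delta:
  fixes K (structure)
  assumes "field K" "finite (carrier G)"
  shows "module.span K (group_algebra K G) (delta K G ` carrier G) = carrier (group_algebra K G)"
proof -
  interpret field K by fact
  interpret V: vectorspace K "group_algebra K G"
    by (rule group_algebra_vectorspace) fact
  let ?D = "delta K G ` carrier G"
  have D: "?D \<subseteq> carrier (group_algebra K G)"
    by (intro image_subsetI delta_closed assms(1))
  interpret S: submodule K "V.span ?D" "group_algebra K G"
    by (rule V.span_is_submodule[OF D])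
  \<comment> \<open>The induction runs over a finite set \<open>A\<close> containing the support,
    with \<open>v\<close> arbitrary, so that the hypothesis applies to \<open>v\<close> with one
    coefficient erased.\<close>
  have "v \<in> V.span ?D"
    if "finite A" "A \<subseteq> carrier G" "v \<in> carrier (group_algebra K G)" "supp K G v \<subseteq> A" for A v
    using that
  proof (induction A arbitrary: v rule: finite_induct)
    case empty
    then have "v = \<zero>\<^bsub>group_algebra K G\<^esub>"
      by (auto simp: supp_def fun_eq_iff PiE_iff extensional_def)
    then show ?case
      using S.zero_closed by metis
  next
    case (insert a A)
    let ?w = "v(a := \<zero>)"
    have a: "a \<in> carrier G" and va: "v a \<in> carrier K"
      using insert.prems by auto
    have "?w \<in> V.span ?D"
      using insert.prems a by (intro insert.IH) (auto simp: supp_def PiE_iff extensional_def)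
    moreover have "v a \<odot>\<^bsub>group_algebra K G\<^esub> delta K G a \<in> V.span ?D"
      using V.in_own_span[OF D] a va by (intro S.smult_closed) auto
    ultimately have "v a \<odot>\<^bsub>group_algebra K G\<^esub> delta K G a \<oplus>\<^bsub>group_algebra K G\<^esub> ?w \<in> V.span ?D"
      by (rule S.m_closed[rotated])
    moreover have "v a \<odot>\<^bsub>group_algebra K G\<^esub> delta K G a \<oplus>\<^bsub>group_algebra K G\<^esub> ?w = v"
      using insert.prems a va
      by (auto simp: delta_def fun_eq_iff PiE_iff extensional_def)
    ultimately show ?case
      by simp
  qed
  from this[of "carrier G"] show ?thesis
    using V.span_is_subset2[OF D] assms(2) by (auto simp: supp_def)
qed

text \<open>In the convolution sum only the index \<open>h\<close> with \<open>inv h * g = z\<close>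
  contributes, so the result is the right translate of \<open>f\<close> by \<open>z\<close>.\<close>

lemma left_mult_delta:
  fixes K (structure)
  assumes "field K" "group G" "finite (carrier G)" "f \<in> carrier (group_algebra K G)"
    and "z \<in> carrier G" "g \<in> carrier G"
  shows "left_mult K G f (delta K G z) g = f (g \<otimes>\<^bsub>G\<^esub> inv\<^bsub>G\<^esub> z)"
proof -
  interpret field K by fact
  interpret G: group G by fact
  have f: "f x \<in> carrier K" if "x \<in> carrier G" for x
    using assms(4) that by auto
  \<comment> \<open>Solving for the summation index brings the condition into the form that
    \<open>finsum_singleton\<close> expects.\<close>
  have eq: "inv\<^bsub>G\<^esub> h \<otimes>\<^bsub>G\<^esub> g = z \<longleftrightarrow> g \<otimes>\<^bsub>G\<^esub> inv\<^bsub>G\<^esub> z = h" if "h \<in> carrier G" for h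
    using that assms(5,6) by (metis G.inv_closed G.inv_solve_left' G.inv_solve_right')
  have "left_mult K G f (delta K G z) g =
      (\<Oplus>h\<in>carrier G. f h \<otimes> delta K G z (inv\<^bsub>G\<^esub> h \<otimes>\<^bsub>G\<^esub> g))"
    using assms(6) by (simp add: left_mult_def)
  also have "\<dots> = (\<Oplus>h\<in>carrier G. if g \<otimes>\<^bsub>G\<^esub> inv\<^bsub>G\<^esub> z = h then f h else \<zero>)"
    using assms(5,6) f by (intro finsum_cong') (auto simp: delta_def eq)
  also have "\<dots> = f (g \<otimes>\<^bsub>G\<^esub> inv\<^bsub>G\<^esub> z)"
    using assms(3,5,6) f by (intro finsum_singleton) auto
  finally show ?thesis .
qed

lemma supp_left_mult_delta:
  assumes "field K" "group G" "finite (carrier G)" "f \<in> carrier (group_algebra K G)"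
    and z: "z \<in> carrier G"
  shows "supp K G (left_mult K G f (delta K G z)) = (\<lambda>x. x \<otimes>\<^bsub>G\<^esub> z) ` supp K G f"
proof -
  interpret G: group G by fact
  have "supp K G (left_mult K G f (delta K G z)) =
      {g \<in> carrier G. g \<otimes>\<^bsub>G\<^esub> inv\<^bsub>G\<^esub> z \<in> supp K G f}"
    using left_mult_delta[OF assms] z by (auto simp: supp_def)
  also have "\<dots> = (\<lambda>x. x \<otimes>\<^bsub>G\<^esub> z) ` supp K G f"
  proof (intro equalityI subsetI)
    fix g assume "g \<in> {g \<in> carrier G. g \<otimes>\<^bsub>G\<^esub> inv\<^bsub>G\<^esub> z \<in> supp K G f}"
    then show "g \<in> (\<lambda>x. x \<otimes>\<^bsub>G\<^esub> z) ` supp K G f"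
      using z by (intro image_eqI[of _ _ "g \<otimes>\<^bsub>G\<^esub> inv\<^bsub>G\<^esub> z"]) (auto simp: G.m_assoc)
  qed (use z in \<open>auto simp: supp_def G.m_assoc\<close>)
  finally show ?thesis .
qed

theorem theorem2p4:
  fixes K :: "('k, 'm) ring_scheme" and G :: "('g, 'n) monoid_scheme" and f :: "'g \<Rightarrow> 'k"
  assumes "field K"
    and "group G"
    and "finite (carrier G)"
    and "f \<in> carrier (group_algebra K G)"
    and "f \<noteq> \<zero>\<^bsub>group_algebra K G\<^esub>"
  shows "card (supp K G f) *
      linear_rank K (group_algebra K G) (group_algebra K G) (left_mult K G f) \<ge> order G"
proof -
  let ?V = "group_algebra K G"
  let ?T = "left_mult K G f"
  let ?W = "?T ` carrier ?V"
  let ?E = "?T ` delta K G ` carrier G"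
  interpret G: group G by fact
  interpret V: vectorspace K ?V
    by (rule group_algebra_vectorspace) fact
  interpret T: linear_map K ?V ?V ?T
    by (rule left_mult_linear_map) fact+
  have D: "delta K G ` carrier G \<subseteq> carrier ?V"
    by (intro image_subsetI delta_closed assms(1))
  have sub: "subspace K ?W ?V"
    using T.imT_is_subspace by (simp add: T.im_def)
  then have subm: "submodule K ?W ?V"
    by simp
  interpret W: vectorspace K "?V\<lparr>carrier := ?W\<rparr>"
    by (rule V.subspace_is_vs) fact
  \<comment> \<open>\<open>linear_rank\<close> is the dimension of the image as a space
    \<open>W\<close> of its own, whereas supports are bounded in \<open>KG\<close>; this equality
    moves spans between the two.\<close>
  have span_W: "W.span S = V.span S" if "S \<subseteq> ?W" for S
    using V.span_li_not_depend(1)[OF that subm] .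
  have E: "?E \<subseteq> ?W" "finite ?E"
    using D assms(3) by auto
  have "?W \<subseteq> W.span ?E"
    using T.image_span_subset[OF D] span_delta[OF assms(1,3)] span_W[OF E(1)] by simp
  moreover have "W.span ?E \<subseteq> ?W"
    using W.span_is_subset2[of ?E] E by simp
  ultimately have "W.gen_set ?E"
    by simp
  then obtain B where B: "B \<subseteq> ?E" and basis: "W.basis B"
    using W.basis_subset_generating[of ?E] E by auto
  have fin_B: "finite B"
    using B E(2) by (rule finite_subset)
  have rank: "linear_rank K ?V ?V ?T = card B"
    using W.dim_basis[OF fin_B basis] by (simp add: linear_rank_def)
  define U where "U = (\<Union>b\<in>B. supp K G b)"
  have B_V: "B \<subseteq> carrier ?V"
    using B D by blast
  have W_supp: "?W \<subseteq> {v \<in> carrier ?V. supp K G v \<subseteq> U}"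
  proof -
    have "W.span B = ?W"
      using basis unfolding W.basis_def by simp
    then have "?W = V.span B"
      using span_W[OF subset_trans[OF B E(1)]] by simp
    also have "\<dots> \<subseteq> {v \<in> carrier ?V. supp K G v \<subseteq> U}"
      using B_V by (intro V.span_is_subset supp_submodule assms(1)) (auto simp: U_def)
    finally show ?thesis .
  qed
  \<comment> \<open>Here \<open>f\<close> being nonzero enters: elements of \<open>KG\<close> agree
    outside \<open>G\<close>, so some coefficient at a group element is nonzero.\<close>
  obtain x where x: "x \<in> carrier G" "x \<in> supp K G f"
    using assms(4,5) by (auto simp: supp_def fun_eq_iff PiE_iff extensional_def split: if_splits)
  have "carrier G \<subseteq> U"
  proof
    fix g assume g: "g \<in> carrier G"
    \<comment> \<open>Translating by this element moves the support point \<open>x\<close> of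
      \<open>f\<close> to \<open>g\<close>. The translate may fail to be in \<open>B\<close>, but it
      lies in the image, so \<open>W_supp\<close> still puts \<open>g\<close> in
      \<open>U\<close>.\<close>
    let ?z = "inv\<^bsub>G\<^esub> x \<otimes>\<^bsub>G\<^esub> g"
    have z: "?z \<in> carrier G" and "g = x \<otimes>\<^bsub>G\<^esub> ?z"
      using g x(1) by (simp_all add: G.m_assoc[symmetric])
    then have "g \<in> supp K G (?T (delta K G ?z))"
      using supp_left_mult_delta[OF assms(1-4) z] x(2) by blast
    moreover have "?T (delta K G ?z) \<in> ?W"
      using D z by blast
    ultimately show "g \<in> U"
      using W_supp by blast
  qed
  have "finite U"
    using assms(3) fin_B by (auto simp: U_def supp_def)
  then have "order G \<le> card U"
    using \<open>carrier G \<subseteq> U\<close> by (simp add: order_def card_mono)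
  also have "\<dots> \<le> (\<Sum>b\<in>B. card (supp K G b))"
    unfolding U_def by (rule card_UN_le[OF fin_B])
  \<comment> \<open>Each \<open>b\<close> is a translate of \<open>f\<close>, so its support is an
    image of \<open>supp K G f\<close>; the upper bound on its size suffices.\<close>
  also have "\<dots> \<le> (\<Sum>b\<in>B. card (supp K G f))"
  proof (rule sum_mono)
    fix b assume "b \<in> B"
    then obtain z where "z \<in> carrier G" "b = ?T (delta K G z)"
      using B by blast
    then show "card (supp K G b) \<le> card (supp K G f)"
      using supp_left_mult_delta[OF assms(1-4)] assms(3) by (simp add: card_image_le supp_def)
  qed
  finally show ?thesis
    by (simp add: rank mult.commute)
qed

end
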